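(* Let $(R_k)_{k\in\mathbb{N}}$ be a sequence of rectangles in $\mathbb{R}^2$ (of arbitrary orientations) centered at the origin, whose diameters tend to $0$ as $k\to\infty$. For $k\in\mathbb{N}$ let $$Q_k:=\left|\bigcup_{l=k}^\infty (R_k-R_l)\right|,$$ and assume that $Q_k<\infty$ for each $k\in\mathbb{N}$. Fix $1\leq p<\infty$. Define $W_{k,1}:=Q_k$ and, in case $1<p<\infty$, $$W_{k,p}:=(Q_k)^{\frac 1p}\,|R_k|^{\frac{1}{p'}},$$ where $1<p'<\infty$ satisfies $\frac1p+\frac1{p'}=1$. Then the corrected maximal operator $T_p^*$ defined for any locally integrable $f$ on $\mathbb{R}^2$ and any $x\in\mathbb{R}^2$ by $$T_p^*f(x):=\sup_{k\in\mathbb{N}}\left|\frac{1}{W_{k,p}}\int_{x+R_k} f\right|$$ has weak type $(p,p)$.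
   Context: Rectangles are solid, closed and non-degenerate (both side-lengths positive), and need not be parallel to the coordinate axes. $|E|$ denotes the Lebesgue measure of $E\subseteq\mathbb{R}^2$. For sets $E,F\subseteq\mathbb{R}^2$, $E-F:=\{x-y: x\in E,\ y\in F\}$ is the set of differences. An operator $S$ has weak type $(p,p)$ if there is a constant $C>0$ such that for all $f\in L^p(\mathbb{R}^2)$ and all $\lambda>0$, $|\{x\in\mathbb{R}^2: |Sf(x)|>\lambda\}|\leq \frac{C}{\lambda^p}\|f\|_p^p$. *)

theory Defs
  imports "HOL-Analysis.Analysis"
begin

text \<open>Solid closed rectangle with centre \<open>c\<close> and side-lengths \<open>a, b > 0\<close>; the orthonormal
  pair \<open>u, v\<close> gives the directions of its sides.\<close>

definition rectangle_centered_at :: "real^2 \<Rightarrow> (real^2) set \<Rightarrow> bool" where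
  "rectangle_centered_at c R \<longleftrightarrow>
     (\<exists>u v a b. norm u = 1 \<and> norm v = 1 \<and> u \<bullet> v = 0 \<and> a > 0 \<and> b > 0 \<and>
        R = {c + s *\<^sub>R u + t *\<^sub>R v | s t. \<bar>s\<bar> \<le> a / 2 \<and> \<bar>t\<bar> \<le> b / 2})"

text \<open>The infix minus on sets is the set-theoretic difference, hence a separate name for
  \<open>E - F\<close> in the sense of Minkowski.\<close>

definition set_of_differences :: "(real^2) set \<Rightarrow> (real^2) set \<Rightarrow> (real^2) set" where
  "set_of_differences E F = {x - y | x y. x \<in> E \<and> y \<in> F}"

definition Q :: "(nat \<Rightarrow> (real^2) set) \<Rightarrow> nat \<Rightarrow> ennreal" where
  "Q R k = emeasure lebesgue (\<Union>l\<in>{k..}. set_of_differences (R k) (R l))"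

definition conjugate_exponent :: "real \<Rightarrow> real" where
  "conjugate_exponent p = p / (p - 1)"

lemma conjugate_exponent:
  assumes "p > 1"
  shows "conjugate_exponent p > 1" "1 / p + 1 / conjugate_exponent p = 1"
  using assms by (simp_all add: conjugate_exponent_def field_simps)

text \<open>Meaningful when \<open>Q R k\<close> is finite.\<close>

definition W :: "(nat \<Rightarrow> (real^2) set) \<Rightarrow> nat \<Rightarrow> real \<Rightarrow> real" where
  "W R k p = (if p = 1 then enn2real (Q R k)
     else enn2real (Q R k) powr (1 / p) * measure lebesgue (R k) powr (1 / conjugate_exponent p))"

text \<open>The scalar field \<open>'a\<close> is \<open>real\<close> or \<open>complex\<close>. The supremum may be infinite, so the
  operator is extended-real-valued. For \<open>f\<close> that is not locally integrable the value
  is irrelevant.\<close>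

definition corrected_maximal ::
  "(nat \<Rightarrow> (real^2) set) \<Rightarrow> real \<Rightarrow>
   (real^2 \<Rightarrow> 'a::{real_normed_field, banach, second_countable_topology}) \<Rightarrow> real^2 \<Rightarrow> ereal" where
  "corrected_maximal R p f x =
     (SUP k. ereal (norm ((1 / W R k p) *\<^sub>R (LINT y:((+) x ` R k)|lebesgue. f y))))"

definition Lp_space ::
  "real \<Rightarrow> (real^2 \<Rightarrow> 'a::{real_normed_field, banach, second_countable_topology}) set" where
  "Lp_space p = {f. f \<in> borel_measurable lebesgue \<and> integrable lebesgue (\<lambda>x. norm (f x) powr p)}"

definition Lp_norm ::
  "real \<Rightarrow> (real^2 \<Rightarrow> 'a::{real_normed_field, banach, second_countable_topology}) \<Rightarrow> real" where
  "Lp_norm p f = (LINT x|lebesgue. norm (f x) powr p) powr (1 / p)"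

text \<open>Measurability of the superlevel sets is part of the definition, because \<open>emeasure\<close> is \<open>0\<close>
  on non-measurable sets.\<close>

definition weak_type ::
  "real \<Rightarrow> ((real^2 \<Rightarrow> 'a::{real_normed_field, banach, second_countable_topology})
     \<Rightarrow> real^2 \<Rightarrow> ereal) \<Rightarrow> bool" where
  "weak_type p S \<longleftrightarrow>
     (\<exists>C>0. \<forall>f\<in>Lp_space p. \<forall>r>0.
        {x. \<bar>S f x\<bar> > ereal r} \<in> sets lebesgue \<and>
        emeasure lebesgue {x. \<bar>S f x\<bar> > ereal r}
          \<le> ennreal (C / r powr p * Lp_norm p f powr p))"

end

theory Submission
  imports Defs
begin

text \<open>
  The proof is a Vitali covering argument that yields the weak type inequality with constant 1.
  Call \<open>x + R\<^sub>k\<close> a tile of rank \<open>k\<close>, and call it heavy if the corrected average of \<open>f\<close> over it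
  exceeds \<open>r\<close>; the superlevel set of the maximal function consists of the points \<open>x\<close> carrying
  a heavy tile of some rank.

  A greedy selection in order of increasing rank (\<open>greedy_disjoint_subfamily\<close>) extracts from the
  heavy tiles a pairwise disjoint family such that every heavy tile \<open>x + R\<^sub>k\<close> meets a selected tile
  \<open>x' + R\<^sub>j\<close> with \<open>j \<le> k\<close>. Then \<open>x\<close> lies in \<open>x' + (R\<^sub>j - R\<^sub>k)\<close>, and so in the translate by \<open>x'\<close>
  of the union of the sets \<open>R\<^sub>j - R\<^sub>l\<close> over all \<open>l \<ge> j\<close>, whose measure is \<open>Q\<^sub>j\<close>. Selecting
  by rank instead of by size is what makes the one-sided union in \<open>Q\<^sub>j\<close> the right correction.

  It remains to pay for \<open>Q\<^sub>j\<close> with the mass of \<open>\<bar>f\<bar>\<^sup>p\<close> on the selected tile. The weight \<open>W\<close> is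
  chosen so that the power mean inequality (\<open>powr_set_integral_le\<close>) does precisely this: the powers
  of \<open>\<bar>R\<^sub>j\<bar>\<close> cancel and heaviness gives \<open>r\<^sup>p Q\<^sub>j \<le> \<integral>\<bar>f\<bar>\<^sup>p\<close> over the tile
  (\<open>Q_le_of_large_average\<close>). Since the selected tiles are disjoint, and countable in number because
  they have interior points, summing gives the claim.

  The superlevel sets are measurable because they are open: the average of \<open>f\<close> over \<open>x + R\<^sub>k\<close> is
  continuous in \<open>x\<close> (\<open>continuous_on_window_integral\<close>).
\<close>

section \<open>Selection and summation of disjoint families\<close>

text \<open>
  Well-order the indices so that the rank is non-decreasing, and run through them, keeping an index
  if and only if its set is disjoint from all sets kept so far. An index that is not kept meets an
  earlier one that is, and earlier indices have at most the same rank. The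
  recursion is transfinite even for ranks in the natural numbers, because uncountably many indices
  may share a rank.
\<close>

lemma greedy_disjoint_subfamily:
  fixes rank :: "'i \<Rightarrow> 'o::wellorder"
  assumes nonempty: "\<And>i. i \<in> I \<Longrightarrow> B i \<noteq> {}"
  obtains J where "J \<subseteq> I" "disjoint_family_on B J"
    "\<And>i. i \<in> I \<Longrightarrow> \<exists>j\<in>J. rank j \<le> rank i \<and> B i \<inter> B j \<noteq> {}"
proof -
  obtain r :: "'i rel" where r: "Well_order r" "Field r = UNIV"
    using well_ordering[where 'a = 'i] by auto
  define L where "L = inv_image ({(a, b). a < b} <*lex*> (r - Id)) (\<lambda>i. (rank i, i))"
  have "wf L"
    unfolding L_def using r by (auto intro!: wf_inv_image wf_lex_prod wf simp: well_order_on_def)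
  have total: "(i, j) \<in> L \<or> (j, i) \<in> L" if "i \<noteq> j" for i j
    using r that by (auto simp: L_def well_order_on_def linear_order_on_def total_on_def)
  have rank_mono: "rank j \<le> rank i" if "(j, i) \<in> L" for i j
    using that by (auto simp: L_def)
  define keep where
    "keep = wfrec L (\<lambda>sel i. i \<in> I \<and> (\<forall>j. (j, i) \<in> L \<longrightarrow> sel j \<longrightarrow> B i \<inter> B j = {}))"
  have keep: "keep i \<longleftrightarrow> i \<in> I \<and> (\<forall>j. (j, i) \<in> L \<longrightarrow> keep j \<longrightarrow> B i \<inter> B j = {})" for i
    unfolding keep_def by (subst wfrec[OF \<open>wf L\<close>]) (auto simp: cut_def)
  show thesis
  proof
    show "Collect keep \<subseteq> I"
      using keep by blast
    show "disjoint_family_on B (Collect keep)"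
      unfolding disjoint_family_on_def using total keep by blast
    fix i assume "i \<in> I"
    show "\<exists>j\<in>Collect keep. rank j \<le> rank i \<and> B i \<inter> B j \<noteq> {}"
    proof (cases "keep i")
      case True
      then show ?thesis using nonempty[OF \<open>i \<in> I\<close>] by auto
    next
      case False
      then obtain j where "(j, i) \<in> L" "keep j" "B i \<inter> B j \<noteq> {}"
        using keep \<open>i \<in> I\<close> by blast
      then show ?thesis using rank_mono by blast
    qed
  qed
qed

lemma countable_disjoint_family_nonempty_interior:
  fixes B :: "'i \<Rightarrow> 'a::second_countable_topology set"
  assumes disj: "disjoint_family_on B J" and int: "\<And>j. j \<in> J \<Longrightarrow> interior (B j) \<noteq> {}"
  shows "countable J"
proof -
  have ne: "B j \<noteq> {}" if "j \<in> J" for j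
    using int[OF that] interior_subset by blast
  then have "disjoint (B ` J)" "inj_on B J"
    using disj disjoint_family_on_iff_disjoint_image[of J B] by auto
  moreover from this int have "countable (B ` J)"
    by (intro countable_disjoint_nonempty_interior_subsets) auto
  ultimately show ?thesis
    using countable_image_inj_on by blast
qed

text \<open>
  The sets \<open>D j\<close> may overlap, so only their union is controlled, by subadditivity of \<open>M\<close>; the
  disjoint \<open>B j\<close> add up exactly in \<open>N\<close>. The two measures differ because the application compares
  volume with the mass of \<open>\<bar>f\<bar>\<^sup>p\<close>.
\<close>

lemma emeasure_countable_UN_le:
  assumes J: "countable J" and disj: "disjoint_family_on B J"
    and B: "\<And>j. j \<in> J \<Longrightarrow> B j \<in> sets N" and D: "\<And>j. j \<in> J \<Longrightarrow> D j \<in> sets M"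
    and le: "\<And>j. j \<in> J \<Longrightarrow> emeasure M (D j) \<le> emeasure N (B j)"
  shows "emeasure M (\<Union>j\<in>J. D j) \<le> emeasure N (\<Union>j\<in>J. B j)"
proof -
  define g where "g = from_nat_into J"
  define h where "h = to_nat_on J"
  have gh: "g (h j) = j" if "j \<in> J" for j
    using J that by (simp add: g_def h_def)
  \<comment> \<open>The index set may be finite, so unused positions of the sequence are filled with the empty set.\<close>
  define B' where "B' n = (if n \<in> h ` J then B (g n) else {})" for n
  define D' where "D' n = (if n \<in> h ` J then D (g n) else {})" for n
  have UB: "(\<Union>n. B' n) = (\<Union>j\<in>J. B j)" and UD: "(\<Union>n. D' n) = (\<Union>j\<in>J. D j)"
    by (auto simp: B'_def D'_def gh split: if_splits)
  have disj': "disjoint_family B'"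
    unfolding disjoint_family_on_def
  proof (intro ballI impI)
    fix m n :: nat assume "m \<noteq> n"
    then show "B' m \<inter> B' n = {}"
      using disj by (auto simp: B'_def gh disjoint_family_on_def) (metis disjoint_iff)
  qed
  have "emeasure M (\<Union>n. D' n) \<le> (\<Sum>n. emeasure M (D' n))"
    by (rule emeasure_subadditive_countably) (auto simp: D'_def gh D)
  also have "\<dots> \<le> (\<Sum>n. emeasure N (B' n))"
    by (rule suminf_le) (auto simp: D'_def B'_def gh le)
  also have "\<dots> = emeasure N (\<Union>n. B' n)"
    by (rule suminf_emeasure) (rule disj' | (use B gh in \<open>force simp: B'_def\<close>))+
  finally show ?thesis by (simp only: UB UD)
qed

section \<open>The power mean inequality\<close>

text \<open>The right-hand side is convex in \<open>x\<close>, and the left-hand side is its tangent at \<open>1\<close>.\<close>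

lemma Bernoulli_inequality_powr:
  fixes x p :: real
  assumes "1 \<le> p" "0 \<le> x"
  shows "1 + p * (x - 1) \<le> x powr p"
proof (cases "x = 0")
  case True
  then show ?thesis using assms by simp
next
  case False
  have "x powr p - 1 powr p \<ge> p * (x - 1)"
  proof (rule convex_on_imp_above_tangent[where A = "{0<..}"])
    show "convex_on {0<..} (\<lambda>x. x powr p)" by (rule powr_convex) fact
    show "((\<lambda>x. x powr p) has_real_derivative p) (at 1 within {0<..})"
      by (auto intro!: derivative_eq_intros)
  qed (use assms False in \<open>auto simp: interior_open\<close>)
  then show ?thesis by simp
qed

text \<open>
  Let \<open>t\<close> be the mean of \<open>g\<close> on \<open>E\<close>. The graph of \<open>y powr p\<close> lies above its tangent at \<open>t\<close>;
  integrating this over \<open>E\<close>, the linear term vanishes by the choice of \<open>t\<close>, which leaves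
  \<open>t powr p * measure M E \<le> \<integral>g powr p\<close>. This is Hoelder's inequality against the
  constant function 1, and it covers \<open>p = 1\<close> without a separate case.
\<close>

lemma powr_set_integral_le:
  fixes g :: "'a \<Rightarrow> real"
  assumes p: "1 \<le> p" and E: "E \<in> fmeasurable M" and pos: "0 < measure M E"
    and nonneg: "\<And>x. 0 \<le> g x"
    and g: "set_integrable M E g" and gp: "set_integrable M E (\<lambda>x. g x powr p)"
  shows "(LINT x:E|M. g x) powr p \<le> measure M E powr (p - 1) * (LINT x:E|M. g x powr p)"
proof -
  define m where "m = measure M E"
  define t where "t = (LINT x:E|M. g x) / m"
  have m: "0 < m" using pos by (simp add: m_def)
  have I: "(LINT x:E|M. g x) = t * m" using m by (simp add: t_def)
  have "0 \<le> (LINT x:E|M. g x)"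
    unfolding set_lebesgue_integral_def by (rule integral_nonneg_AE) (simp add: nonneg)
  then have "0 \<le> t" using m by (simp add: t_def)
  show ?thesis
  proof (cases "t = 0")
    case True
    then show ?thesis
      using p unfolding I by (simp add: set_lebesgue_integral_def nonneg integral_nonneg_AE)
  next
    case False
    with \<open>0 \<le> t\<close> have t: "0 < t" by simp
    \<comment> \<open>Bernoulli's inequality at \<open>y / t\<close>, scaled by \<open>t powr p\<close>.\<close>
    have tangent: "t powr p + p * t powr (p - 1) * (y - t) \<le> y powr p" if "0 \<le> y" for y
    proof -
      define c where "c = t powr (p - 1)"
      have "t powr p * (1 + p * (y / t - 1)) \<le> t powr p * (y / t) powr p"
        using Bernoulli_inequality_powr[OF p, of "y / t"] that t by (intro mult_left_mono) auto
      moreover have tp: "t powr p = c * t"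
        using t by (simp add: c_def powr_diff)
      moreover have "t powr p * (y / t) powr p = y powr p"
        using t that by (simp add: powr_divide)
      ultimately have "c * t * (1 + p * (y / t - 1)) \<le> y powr p" by simp
      moreover have "c * t * (1 + p * (y / t - 1)) = c * t + p * c * (y - t)"
        using t by (simp add: field_simps)
      ultimately show ?thesis by (simp add: tp c_def)
    qed
    have const: "set_integrable M E (\<lambda>x. c)" for c :: real
      unfolding set_integrable_def using E by (auto simp: fmeasurable_def)
    have lin: "set_integrable M E (\<lambda>x. p * t powr (p - 1) * (g x - t))"
      using set_integral_diff(1)[OF g const] by simp
    have "t powr p * m = t powr p * m + p * t powr (p - 1) * ((LINT x:E|M. g x) - t * m)"
      by (simp add: I)
    also have "\<dots> = (LINT x:E|M. t powr p + p * t powr (p - 1) * (g x - t))"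
      using E const lin g
      by (simp add: set_integral_add set_integral_diff m_def set_integral_const
          fmeasurableD fmeasurableD2 less_top)
    also have "\<dots> \<le> (LINT x:E|M. g x powr p)"
      by (rule set_integral_mono) (use tangent nonneg const lin gp in \<open>auto intro: set_integral_add\<close>)
    finally have "m powr (p - 1) * (t powr p * m) \<le> m powr (p - 1) * (LINT x:E|M. g x powr p)"
      by (rule mult_left_mono) simp
    moreover have "m powr (p - 1) * (t powr p * m) = (t * m) powr p"
      using t m by (simp add: powr_mult powr_diff)
    ultimately show ?thesis by (simp add: I m_def)
  qed
qed

section \<open>Local averages of integrable functions\<close>

text \<open>
  If the centres \<open>X n\<close> converge to \<open>x\<close>, the indicators of the windows \<open>X n + K\<close> converge to that of
  \<open>x + K\<close> at every point off the frontier of \<open>x + K\<close>, a null set by convexity. All windows stay in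
  one ball, on which \<open>f\<close> is integrable, so dominated convergence applies.
\<close>

lemma continuous_on_window_integral:
  fixes f :: "'a::euclidean_space \<Rightarrow> 'b::{banach, second_countable_topology}"
  assumes K: "compact K" "convex K"
    and f: "\<And>S. compact S \<Longrightarrow> set_integrable lebesgue S f"
  shows "continuous_on UNIV (\<lambda>x. LINT y:((+) x ` K)|lebesgue. f y)"
  unfolding continuous_on_sequentially
proof (intro allI ballI impI, elim conjE)
  fix X :: "nat \<Rightarrow> 'a" and x assume X: "X \<longlonglongrightarrow> x"
  obtain b where b: "\<And>y. y \<in> K \<Longrightarrow> norm y \<le> b"
    using compact_imp_bounded[OF K(1)] by (auto simp: bounded_iff)
  obtain c where c: "\<And>n. norm (X n) \<le> c"
    using convergent_imp_Bseq[of X] X by (auto simp: convergent_def Bseq_def)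
  define S where "S = cball (0::'a) (c + b)"
  have tile: "(indicator ((+) z ` K) y :: real) = indicator K (y - z)" for y z
    by (auto simp: indicator_def image_iff algebra_simps intro!: bexI[of _ "y - z"])
  have mble: "(\<lambda>y. indicator ((+) z ` K) y *\<^sub>R f y) \<in> borel_measurable lebesgue" for z
    using f[OF compact_translation[OF K(1)]] unfolding set_integrable_def by (rule borel_measurable_integrable)
  have "(\<lambda>n. LINT y|lebesgue. indicator ((+) (X n) ` K) y *\<^sub>R f y)
      \<longlonglongrightarrow> (LINT y|lebesgue. indicator ((+) x ` K) y *\<^sub>R f y)"
  proof (rule integral_dominated_convergence[where w = "\<lambda>y. norm (indicator S y *\<^sub>R f y)"])
    show "integrable lebesgue (\<lambda>y. norm (indicator S y *\<^sub>R f y))"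
      using f[of S] unfolding set_integrable_def S_def by (intro integrable_norm) auto
    have "(+) x ` frontier K \<in> null_sets lebesgue"
      unfolding negligible_iff_null_sets[symmetric]
      by (intro negligible_translation negligible_convex_frontier K)
    then have "AE y in lebesgue. y \<notin> (+) x ` frontier K"
      by (rule AE_not_in)
    then show "AE y in lebesgue. (\<lambda>n. indicator ((+) (X n) ` K) y *\<^sub>R f y)
        \<longlonglongrightarrow> indicator ((+) x ` K) y *\<^sub>R f y"
    proof eventually_elim
      fix y assume "y \<notin> (+) x ` frontier K"
      then have y: "y - x \<notin> frontier K"
        by (metis add_diff_cancel_left' diff_add_cancel image_eqI add.commute)
      have lim: "(\<lambda>n. y - X n) \<longlonglongrightarrow> y - x"
        using X by (intro tendsto_intros)
      have "eventually (\<lambda>n. y - X n \<in> K \<longleftrightarrow> y - x \<in> K) sequentially"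
      proof (cases "y - x \<in> K")
        case True
        then have "y - x \<in> interior K"
          using y by (auto simp: frontier_def closure_def)
        from topological_tendstoD[OF lim open_interior this] show ?thesis
          by eventually_elim (use True interior_subset in blast)
      next
        case False
        have "open (- K)" using K(1) by (simp add: compact_imp_closed open_Compl)
        from topological_tendstoD[OF lim this] False show ?thesis
          by (auto elim: eventually_mono)
      qed
      then have "eventually (\<lambda>n. indicator ((+) (X n) ` K) y *\<^sub>R f y = indicator ((+) x ` K) y *\<^sub>R f y)
          sequentially"
        by eventually_elim (simp only: tile, simp only: indicator_def)
      then show "(\<lambda>n. indicator ((+) (X n) ` K) y *\<^sub>R f y) \<longlonglongrightarrow> indicator ((+) x ` K) y *\<^sub>R f y"
        by (rule tendsto_eventually)
    qed
    fix n
    have "(+) (X n) ` K \<subseteq> S"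
      using b c by (auto simp: S_def intro!: norm_triangle_mono)
    then show "AE y in lebesgue. norm (indicator ((+) (X n) ` K) y *\<^sub>R f y)
        \<le> norm (indicator S y *\<^sub>R f y)"
      by (auto simp: indicator_def)
  qed (use mble in auto)
  then show "((\<lambda>x. LINT y:((+) x ` K)|lebesgue. f y) \<circ> X) \<longlonglongrightarrow> (LINT y:((+) x ` K)|lebesgue. f y)"
    by (simp add: set_lebesgue_integral_def comp_def)
qed

text \<open>On a set of finite measure, \<open>\<bar>f\<bar> \<le> 1 + \<bar>f\<bar>\<^sup>p\<close> is a bound by an integrable function.\<close>

lemma Lp_space_imp_set_integrable:
  assumes p: "1 \<le> p" and f: "f \<in> Lp_space p" and S: "S \<in> lmeasurable"
  shows "set_integrable lebesgue S f"
proof -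
  have f': "f \<in> borel_measurable lebesgue" "integrable lebesgue (\<lambda>x. norm (f x) powr p)"
    using f by (auto simp: Lp_space_def)
  have meas: "S \<in> sets lebesgue" using S by auto
  show ?thesis
    unfolding set_integrable_def
  proof (rule Bochner_Integration.integrable_bound)
    show "integrable lebesgue (\<lambda>x. indicator S x + norm (f x) powr p)"
      using f' S by (auto simp: fmeasurable_def)
    show "(\<lambda>x. indicator S x *\<^sub>R f x) \<in> borel_measurable lebesgue"
      using f' meas by measurable
    have "y \<le> 1 + y powr p" if "0 \<le> y" for y :: real
    proof (cases "y \<le> 1")
      case True
      then show ?thesis by (smt (verit) powr_ge_zero)
    next
      case False
      then show ?thesis using powr_mono[OF p, of y] by simp
    qed
    then show "AE x in lebesgue. norm (indicator S x *\<^sub>R f x)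
        \<le> norm (indicator S x + norm (f x) powr p)"
      by (auto simp: indicator_def)
  qed
qed

section \<open>Rectangles\<close>

text \<open>
  A rectangle is a translate of the linear image of a box, which gives compactness and convexity.
  For the interior point, \<open>u\<close> and \<open>v\<close> form an orthonormal basis of the plane, so the
  coordinates of a vector are at most its norm, and the disc around the centre whose radius is half
  the shorter side is contained in the rectangle.
\<close>

lemma rectangle_compact_convex_interior:
  assumes "rectangle_centered_at c R"
  shows "compact R" "convex R" "c \<in> interior R"
proof -
  obtain u v a b where uv: "norm u = 1" "norm v = 1" "u \<bullet> v = 0" and ab: "a > 0" "b > 0"
    and R: "R = {c + s *\<^sub>R u + t *\<^sub>R v | s t. \<bar>s\<bar> \<le> a / 2 \<and> \<bar>t\<bar> \<le> b / 2}"
    using assms unfolding rectangle_centered_at_def by blast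
  define h where "h = (\<lambda>z :: real \<times> real. fst z *\<^sub>R u + snd z *\<^sub>R v)"
  have h: "linear h"
    unfolding h_def by (intro linearI) (auto simp: algebra_simps)
  have R_image: "R = (+) c ` h ` ({- a / 2..a / 2} \<times> {- b / 2..b / 2})"
  proof -
    have "R = (\<lambda>(s, t). c + (s *\<^sub>R u + t *\<^sub>R v)) ` ({- a / 2..a / 2} \<times> {- b / 2..b / 2})"
      unfolding R by (fastforce simp: abs_le_iff image_iff add.assoc)
    then show ?thesis by (simp add: h_def image_image case_prod_unfold)
  qed
  show "compact R"
    unfolding R_image
    by (intro compact_translation compact_continuous_image compact_Times linear_continuous_on)
       (use h in \<open>auto simp: linear_conv_bounded_linear\<close>)
  show "convex R"
    unfolding R_image
    by (intro convex_translation convex_linear_image convex_Times h) auto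
  have "independent {u, v}"
    by (rule pairwise_orthogonal_independent)
      (use uv in \<open>auto simp: pairwise_def orthogonal_def inner_commute\<close>)
  moreover have "u \<noteq> v" using uv by (metis norm_eq_1 zero_neq_one)
  ultimately have "UNIV \<subseteq> span {u, v}"
    by (intro card_ge_dim_independent) auto
  have "ball c (min (a / 2) (b / 2)) \<subseteq> R"
  proof
    fix x assume "x \<in> ball c (min (a / 2) (b / 2))"
    then have x: "norm (x - c) < a / 2" "norm (x - c) < b / 2"
      by (auto simp: dist_norm norm_minus_commute)
    obtain s t where st: "x - c = s *\<^sub>R u + t *\<^sub>R v"
    proof -
      have "x - c \<in> span {u, v}" using \<open>UNIV \<subseteq> span {u, v}\<close> by blast
      then obtain s where "x - c - s *\<^sub>R u \<in> span {v}"
        unfolding span_breakdown_eq[of _ u] by blast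
      then obtain t where "x - c - s *\<^sub>R u = t *\<^sub>R v"
        by (auto simp: span_singleton)
      then show thesis by (intro that[of s t]) (simp add: algebra_simps)
    qed
    have "(x - c) \<bullet> u = s" "(x - c) \<bullet> v = t"
      using uv by (simp_all add: st inner_add_left norm_eq_1 inner_commute[of v u])
    then have "\<bar>s\<bar> \<le> norm (x - c)" "\<bar>t\<bar> \<le> norm (x - c)"
      using Cauchy_Schwarz_ineq2[of "x - c" u] Cauchy_Schwarz_ineq2[of "x - c" v] uv by auto
    moreover have "x = c + s *\<^sub>R u + t *\<^sub>R v"
      using st by (simp add: algebra_simps)
    ultimately show "x \<in> R"
      unfolding R using x by (intro CollectI exI[of _ s] exI[of _ t]) linarith+
  qed
  then show "c \<in> interior R"
    using ab by (intro interiorI[of "ball c (min (a / 2) (b / 2))"]) auto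
qed

lemma measure_pos_of_interior:
  fixes S :: "'a::euclidean_space set"
  assumes S: "S \<in> lmeasurable" and x: "x \<in> interior S"
  shows "0 < measure lebesgue S"
proof -
  have "\<not> negligible (interior S)"
    using x by (intro open_not_negligible) auto
  then have "\<not> negligible S"
    using negligible_subset interior_subset by blast
  then show ?thesis
    using S by (simp add: negligible_iff_measure zero_less_measure_iff)
qed

section \<open>The weights\<close>

context
  fixes R :: "nat \<Rightarrow> (real^2) set" and p :: real
  assumes rect: "\<And>k. rectangle_centered_at 0 (R k)"
    and Q_fin: "\<And>k. Q R k < \<infinity>"
    and p: "1 \<le> p"
begin

lemma union_of_differences_measurable:
  "(\<Union>l\<in>{k..}. set_of_differences (R k) (R l)) \<in> sets lebesgue"
proof -
  have "compact (set_of_differences (R k) (R l))" for l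
    unfolding set_of_differences_def
    by (intro compact_differences rectangle_compact_convex_interior(1)[OF rect])
  then show ?thesis
    by (intro sets.countable_UN') (auto dest: lmeasurable_compact)
qed

text \<open>
  Raised to the power \<open>p\<close>, the two cases in the definition of the weight become one formula, in which
  the power of \<open>\<bar>R\<^sub>k\<bar>\<close> is the one produced by the power mean inequality. Positivity
  of \<open>Q\<^sub>k\<close> comes from \<open>R\<^sub>k \<subseteq> R\<^sub>k - R\<^sub>k\<close>, which holds as \<open>0 \<in> R\<^sub>k\<close>.
\<close>

lemma
  shows W_pos: "0 < W R k p"
    and W_powr: "W R k p powr p = enn2real (Q R k) * measure lebesgue (R k) powr (p - 1)"
proof -
  define q m where "q = enn2real (Q R k)" and "m = measure lebesgue (R k)"
  have lm: "R k \<in> lmeasurable"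
    by (intro lmeasurable_compact rectangle_compact_convex_interior(1)[OF rect])
  have m: "0 < m"
    unfolding m_def using lm rectangle_compact_convex_interior(3)[OF rect]
    by (rule measure_pos_of_interior)
  have "R k \<subseteq> (\<Union>l\<in>{k..}. set_of_differences (R k) (R l))"
    using rectangle_compact_convex_interior(3)[OF rect, of k] interior_subset[of "R k"]
    by (force simp: set_of_differences_def)
  then have "emeasure lebesgue (R k) \<le> Q R k"
    unfolding Q_def by (intro emeasure_mono union_of_differences_measurable)
  then have "m \<le> q"
    unfolding m_def q_def measure_def using Q_fin[of k] by (intro enn2real_mono) auto
  then have q: "0 < q" using m by simp
  have "W R k p = q powr (1 / p) * m powr (1 - 1 / p)"
    using p m q by (auto simp: W_def q_def m_def conjugate_exponent_def diff_divide_distrib)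
  moreover have "(1 - 1 / p) * p = p - 1"
    using p by (simp add: field_simps)
  ultimately show "0 < W R k p" "W R k p powr p = q * m powr (p - 1)"
    using p m q by (simp_all add: powr_mult powr_powr)
qed

text \<open>
  With \<open>E = x + R\<^sub>k\<close> and \<open>m = \<bar>E\<bar>\<close>, largeness of the average and the power mean inequality give
  \<open>r\<^sup>p Q\<^sub>k m powr (p - 1) = (r W\<^sub>k)\<^sup>p \<le> (\<integral>\<bar>f\<bar>)\<^sup>p \<le> m powr (p - 1) * \<integral>\<bar>f\<bar>\<^sup>p\<close>, with integrals
  over \<open>E\<close>; then \<open>m powr (p - 1)\<close> cancels. The conclusion is phrased with a density
  measure so that it can be summed over disjoint tiles by countable additivity.
\<close>

lemma Q_le_of_large_average:
  fixes f :: "real^2 \<Rightarrow> 'a::{real_normed_field, banach, second_countable_topology}"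
  assumes f: "f \<in> Lp_space p" and r: "0 < r"
    and large: "r < norm ((1 / W R k p) *\<^sub>R (LINT y:((+) x ` R k)|lebesgue. f y))"
  shows "Q R k \<le> emeasure (density lebesgue (\<lambda>y. ennreal (norm (f y) powr p / r powr p))) ((+) x ` R k)"
proof -
  define E where "E = (+) x ` R k"
  define m where "m = measure lebesgue (R k)"
  define I where "I = (LINT y:E|lebesgue. norm (f y) powr p)"
  have "compact E"
    unfolding E_def by (intro compact_translation rectangle_compact_convex_interior(1)[OF rect])
  then have E: "E \<in> lmeasurable" by (rule lmeasurable_compact)
  have mE: "measure lebesgue E = m"
    unfolding E_def m_def by (rule measure_translation)
  have m: "0 < m"
    unfolding m_def
    by (rule measure_pos_of_interior[OF lmeasurable_compact])
       (rule rectangle_compact_convex_interior[OF rect])+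
  have fE: "set_integrable lebesgue E f"
    using Lp_space_imp_set_integrable[OF p f E] .
  have fp: "integrable lebesgue (\<lambda>y. norm (f y) powr p)"
    using f by (simp add: Lp_space_def)
  have fpE: "set_integrable lebesgue E (\<lambda>y. norm (f y) powr p)"
    unfolding set_integrable_def using E fp by (intro integrable_mult_indicator) auto
  have W: "0 < W R k p" by (rule W_pos)
  have "r * W R k p < norm (LINT y:E|lebesgue. f y)"
    using large W by (simp add: E_def field_simps)
  also have "\<dots> \<le> (LINT y:E|lebesgue. norm (f y))"
    by (rule set_integral_norm_bound[OF fE])
  finally have "(r * W R k p) powr p \<le> (LINT y:E|lebesgue. norm (f y)) powr p"
    using r W p by (intro powr_mono2) auto
  also have "\<dots> \<le> m powr (p - 1) * I"
    unfolding I_def mE[symmetric]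
    by (rule powr_set_integral_le) (use p E m mE fE fpE in \<open>auto intro: set_integrable_norm\<close>)
  finally have "r powr p * (enn2real (Q R k) * m powr (p - 1)) \<le> m powr (p - 1) * I"
    using r W by (simp add: powr_mult W_powr m_def)
  then have "enn2real (Q R k) \<le> I / r powr p"
    using r m by (simp add: field_simps)
  then have "Q R k \<le> ennreal (I / r powr p)"
    using Q_fin[of k] by (metis ennreal_enn2real ennreal_leI infinity_ennreal_def)
  also have "I / r powr p = (LINT y|lebesgue. indicator E y * (norm (f y) powr p / r powr p))"
    unfolding I_def set_lebesgue_integral_def by simp
  also have "ennreal \<dots> = (\<integral>\<^sup>+y. ennreal (indicator E y * (norm (f y) powr p / r powr p)) \<partial>lebesgue)"
    using fpE by (intro nn_integral_eq_integral[symmetric]) (auto simp: set_integrable_def)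
  also have "\<dots> = (\<integral>\<^sup>+y. ennreal (norm (f y) powr p / r powr p) * indicator E y \<partial>lebesgue)"
    by (intro nn_integral_cong) (auto simp: indicator_def)
  also have "\<dots> = emeasure (density lebesgue (\<lambda>y. ennreal (norm (f y) powr p / r powr p))) E"
    using fp E by (intro emeasure_density[symmetric]) auto
  finally show ?thesis by (simp add: E_def)
qed

end

section \<open>The weak type inequality\<close>

theorem theorem2p2:
  fixes R :: "nat \<Rightarrow> (real^2) set" and p :: real
  assumes "\<And>k. rectangle_centered_at 0 (R k)"
    and "(\<lambda>k. diameter (R k)) \<longlonglongrightarrow> 0"
    and "\<And>k. Q R k < \<infinity>"
    and "1 \<le> p"
  shows "weak_type p
    (corrected_maximal R p ::
      (real^2 \<Rightarrow> 'a::{real_normed_field, banach, second_countable_topology}) \<Rightarrow> real^2 \<Rightarrow> ereal)"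
proof -
  note hyps = assms(1,3,4)
  note rect = rectangle_compact_convex_interior[OF assms(1)]
  have "{x. \<bar>corrected_maximal R p f x\<bar> > ereal r} \<in> sets lebesgue \<and>
      emeasure lebesgue {x. \<bar>corrected_maximal R p f x\<bar> > ereal r}
        \<le> ennreal (1 / r powr p * Lp_norm p f powr p)"
    if f: "f \<in> Lp_space p" and r: "0 < r" for f :: "real^2 \<Rightarrow> 'a" and r :: real
  proof -
    define A where "A k x = norm ((1 / W R k p) *\<^sub>R (LINT y:((+) x ` R k)|lebesgue. f y))" for k x
    \<comment> \<open>\<open>I\<close> indexes the heavy tiles \<open>B\<close>; \<open>D\<close> is the set of possible centres of tiles of equal or
      higher rank that meet the given tile.\<close>
    define I where "I = {(x, k). r < A k x}"
    define B where "B = (\<lambda>(x, k). (+) x ` R k)"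
    define D where "D = (\<lambda>(x, k). (+) x ` (\<Union>l\<in>{k..}. set_of_differences (R k) (R l)))"
    define \<nu> where "\<nu> = density lebesgue (\<lambda>y. ennreal (norm (f y) powr p / r powr p))"
    have fp: "integrable lebesgue (\<lambda>y. norm (f y) powr p)"
      using f by (simp add: Lp_space_def)
    have "0 \<le> corrected_maximal R p f x" for x
      unfolding corrected_maximal_def by (rule SUP_upper2[of 0]) auto
    then have level: "{x. \<bar>corrected_maximal R p f x\<bar> > ereal r} = (\<Union>k. {x. r < A k x})"
      by (auto simp: corrected_maximal_def less_SUP_iff A_def)

    have "open {x. r < A k x}" for k
      unfolding A_def
      by (intro open_Collect_less continuous_intros continuous_on_window_integral rect)
         (use Lp_space_imp_set_integrable[OF assms(4) f] lmeasurable_compact in blast)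
    then have "open (\<Union>k. {x. r < A k x})" by blast
    then have meas: "(\<Union>k. {x. r < A k x}) \<in> sets lebesgue" by auto

    have "B i \<noteq> {}" for i
      using rect(3) interior_subset by (auto simp: B_def split: prod.split)
    then obtain J where J: "J \<subseteq> I" and disj: "disjoint_family_on B J"
      and meets: "\<And>i. i \<in> I \<Longrightarrow> \<exists>j\<in>J. snd j \<le> snd i \<and> B i \<inter> B j \<noteq> {}"
      using greedy_disjoint_subfamily[of I B snd] by metis
    have int: "x \<in> interior (B (x, k))" for x k
      using rect(3)[of k] by (auto simp: B_def interior_translation image_iff)
    have "countable J"
      using disj int by (intro countable_disjoint_family_nonempty_interior) fastforce+
    have cover: "(\<Union>k. {x. r < A k x}) \<subseteq> (\<Union>j\<in>J. D j)"
    proof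
      fix x assume "x \<in> (\<Union>k. {x. r < A k x})"
      then obtain k where "(x, k) \<in> I" by (auto simp: I_def)
      from meets[OF this] obtain x' k' where j: "(x', k') \<in> J" "k' \<le> k"
        and "B (x, k) \<inter> B (x', k') \<noteq> {}" by (metis prod.collapse snd_conv)
      then obtain a b where ab: "a \<in> R k" "b \<in> R k'" "x + a = x' + b"
        by (auto simp: B_def)
      then have "x = x' + (b - a)" by (simp add: algebra_simps)
      with ab j have "x \<in> D (x', k')"
        by (auto simp: D_def set_of_differences_def)
      with j show "x \<in> (\<Union>j\<in>J. D j)" by blast
    qed
    have D: "D j \<in> sets lebesgue" for j
      using union_of_differences_measurable[OF hyps]
      by (auto simp: D_def intro!: lebesgue_sets_translation split: prod.split)
    have "emeasure lebesgue (\<Union>k. {x. r < A k x}) \<le> emeasure lebesgue (\<Union>j\<in>J. D j)"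
      using cover D \<open>countable J\<close> by (intro emeasure_mono sets.countable_UN') auto
    also have "\<dots> \<le> emeasure \<nu> (\<Union>j\<in>J. B j)"
    proof (rule emeasure_countable_UN_le[OF \<open>countable J\<close> disj])
      fix j assume "j \<in> J"
      obtain x k where j: "j = (x, k)" by fastforce
      have "compact (B j)" using rect(1) by (auto simp: B_def j intro: compact_translation)
      then show "B j \<in> sets \<nu>"
        using lmeasurable_compact by (auto simp: \<nu>_def)
      show "D j \<in> sets lebesgue" by (rule D)
      have "emeasure lebesgue (D j) = Q R k"
        using emeasure_lebesgue_affine[of 1 x] by (simp add: D_def j Q_def add.commute[of _ x])
      then show "emeasure lebesgue (D j) \<le> emeasure \<nu> (B j)"
        using Q_le_of_large_average[OF hyps f r, of k x] \<open>j \<in> J\<close> J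
        by (auto simp: \<nu>_def B_def I_def A_def j)
    qed
    also have "\<dots> \<le> emeasure \<nu> (space \<nu>)"
      by (rule emeasure_space)
    also have "\<dots> = (\<integral>\<^sup>+y. ennreal (norm (f y) powr p / r powr p) \<partial>lebesgue)"
      unfolding \<nu>_def using fp by (subst emeasure_density) auto
    also have "\<dots> = ennreal (1 / r powr p * Lp_norm p f powr p)"
    proof -
      have "Lp_norm p f powr p = (LINT y|lebesgue. norm (f y) powr p)"
        using assms(4) by (simp add: Lp_norm_def powr_powr)
      moreover have "(\<integral>\<^sup>+y. ennreal (norm (f y) powr p / r powr p) \<partial>lebesgue)
          = ennreal (LINT y|lebesgue. norm (f y) powr p / r powr p)"
        using fp by (intro nn_integral_eq_integral) auto
      ultimately show ?thesis by simp
    qed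
    finally show ?thesis using meas by (simp only: level)
  qed
  then show ?thesis
    unfolding weak_type_def using zero_less_one[where 'a = real] by blast
qed

end
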